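(* Let $a\in\mathbb R\setminus\{0\}$. Then: (i) the functions $f_1(z)=G(ia;iz)$ and $f_2(z)=\overline{G(1+ia;i\overline z)}$ belong to the Hermite–Biehler class $\overline{HB}$; (ii) for $x\in\mathbb R$, ${}_1F_1(ia;1;ix)\ne0$ and ${}_1F_1(1+ia;1;ix)\neq0$. In particular, all zeros of $z\mapsto{}_1F_1(ia;1;iz)$ lie in the lower half plane $\mathbb C^-=\{\mathrm{Im}\,z<0\}$, while the zeros of $z\mapsto{}_1F_1(1+ia;1;iz)$ lie in the upper half plane $\mathbb C^+=\{\mathrm{Im}\,z>0\}$. Additionally, $$|{}_1F_1(1+ia;1;iz)|\le|{}_1F_1(ia;1;iz)|,\quad \mathrm{Im}\,z\ge0,$$ and the equality holds only for $z\in\mathbb R$; (iii) if $a>0$, the function $y(x)=\arg{}_1F_1(ia;1;ix)$, $y(0)=0$, is real-analytic and non-positive on $\mathbb R$, strictly increasing on the negative and strictly decreasing on the positive semiaxis. For $a<0$ the same assertion is valid replacing $y(x)$ by $-y(x)$. The function $y$ is also the solution of the initial value problem $$x\,y'=a\big(\cos(x-2y)-1\big),\quad y(0)=0;$$ (iv) for $a\in\mathbb R$, the function $$\mathfrak G(x)=x-2\arg\big({}_1F_1(ia;1;ix)\big)=x-2y(x),\quad\mathfrak G(0)=0,$$ is strictly increasing in $\mathbb R$.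
   Context: ${}_1F_1(a;1;\zeta)=\sum_{k=0}^\infty\frac{(a)_k}{(k!)^2}\zeta^k$ is the confluent hypergeometric function, and $G(a;\zeta)={}_1F_1(a;1;\zeta)e^{-\zeta/2}$. The Hermite–Biehler class $\overline{HB}$ is the set of entire functions $E$ with no zeros in $\mathbb C^+=\{\mathrm{Im}\,z>0\}$ and such that $|E(z)|\ge|E(\overline z)|$ for $z\in\mathbb C^+$. The argument in (iii) and (iv) is the continuous branch along $\mathbb R$ normalized to vanish at $x=0$. *)

theory Defs
  imports "HOL-Analysis.Analysis"
begin

definition hyp1F1_1 :: "complex \<Rightarrow> complex \<Rightarrow> complex" where
  "hyp1F1_1 a \<zeta> = (\<Sum>k. pochhammer a k / (fact k)\<^sup>2 * \<zeta> ^ k)"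

text \<open>The defining series converges everywhere, so the value above is never a junk value.\<close>

lemma summable_hyp1F1_1:
  fixes a \<zeta> :: complex
  shows "summable (\<lambda>k. pochhammer a k / (fact k)\<^sup>2 * \<zeta> ^ k)"
proof -
  define t where "t = (\<lambda>k. pochhammer a k / (fact k)\<^sup>2 * \<zeta> ^ k)"
  obtain N :: nat where N: "2 * ((norm a + 1) * norm \<zeta>) \<le> real N"
    using real_arch_simple by blast
  have N': "(norm a + 1) * norm \<zeta> \<le> real (Suc n) / 2" if "n \<ge> N" for n
  proof -
    have "real N \<le> real (Suc n)" using that by simp
    with N have "(norm a + 1) * norm \<zeta> * 2 \<le> real (Suc n)"
      by (metis mult.commute order_trans)
    thus ?thesis by (simp only: le_divide_eq_numeral1)
  qed
  have "norm (t (Suc n)) \<le> 1 / 2 * norm (t n)" if "n \<ge> N" for n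
  proof -
    have t_Suc: "t (Suc n) = t n * ((a + of_nat n) * \<zeta> / (of_nat (Suc n))\<^sup>2)"
      by (simp add: t_def pochhammer_Suc power2_eq_square mult_ac)
    have "norm (a + of_nat n) \<le> norm a + real n"
      using norm_triangle_ineq[of a "of_nat n"] by simp
    also have "\<dots> \<le> (norm a + 1) * real (Suc n)"
      by (simp add: algebra_simps)
    finally have "norm (a + of_nat n) * norm \<zeta> \<le> (norm a + 1) * real (Suc n) * norm \<zeta>"
      by (rule mult_right_mono) simp
    also have "\<dots> = real (Suc n) * ((norm a + 1) * norm \<zeta>)"
      by (simp only: mult_ac)
    also have "\<dots> \<le> real (Suc n) * (real (Suc n) / 2)"
      by (rule mult_left_mono[OF N'[OF that]]) simp
    finally have "norm (a + of_nat n) * norm \<zeta> / (real (Suc n))\<^sup>2 \<le> 1 / 2"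
      by (simp add: divide_le_eq power2_eq_square del: of_nat_Suc)
    hence "norm ((a + of_nat n) * \<zeta> / (of_nat (Suc n))\<^sup>2) \<le> 1 / 2"
      by (simp add: norm_mult norm_divide norm_power del: of_nat_Suc)
    from mult_left_mono[OF this norm_ge_zero[of "t n"]] show ?thesis
      unfolding t_Suc norm_mult[of "t n"] by (simp only: mult.commute)
  qed
  hence "summable t"
    by (intro summable_ratio_test[of "1 / 2" N]) auto
  thus ?thesis by (simp add: t_def)
qed

definition G_hyp :: "complex \<Rightarrow> complex \<Rightarrow> complex" where
  "G_hyp a \<zeta> = hyp1F1_1 a \<zeta> * exp (- \<zeta> / 2)"

definition Hermite_Biehler :: "(complex \<Rightarrow> complex) set" where
  "Hermite_Biehler = {E. E holomorphic_on UNIV \<and>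
     (\<forall>z. Im z > 0 \<longrightarrow> E z \<noteq> 0 \<and> norm (E z) \<ge> norm (E (cnj z)))}"

text \<open>\<open>y\<close> is a continuous branch of the argument of \<open>f\<close> along the real line, vanishing at 0.\<close>

definition is_arg_branch :: "(real \<Rightarrow> complex) \<Rightarrow> (real \<Rightarrow> real) \<Rightarrow> bool" where
  "is_arg_branch f y \<longleftrightarrow>
     continuous_on UNIV y \<and> y 0 = 0 \<and> (\<forall>x. f x = rcis (norm (f x)) (y x))"

definition real_analytic_on :: "(real \<Rightarrow> real) \<Rightarrow> real set \<Rightarrow> bool" where
  "real_analytic_on f S \<longleftrightarrow>
     (\<forall>x\<in>S. \<exists>r>0. \<exists>c. \<forall>h. \<bar>h\<bar> < r \<longrightarrow> (\<lambda>n. c n * h ^ n) sums f (x + h))"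

text \<open>
  Solutions of \<open>x w' = a (cos (x - 2 w) - 1)\<close>, \<open>w 0 = 0\<close>. They are required to be differentiable
  at the singular point 0 as well: this is what makes the initial value problem uniquely
  solvable; for \<open>a \<noteq> 0\<close>, solutions that are merely continuous at 0 are not unique.
\<close>

definition solves_ivp :: "real \<Rightarrow> (real \<Rightarrow> real) \<Rightarrow> bool" where
  "solves_ivp a w \<longleftrightarrow> w 0 = 0 \<and>
     (\<forall>x. w differentiable at x \<and> x * deriv w x = a * (cos (x - 2 * w x) - 1))"

end

theory Submission
  imports Defs "HOL-Complex_Analysis.Cauchy_Integral_Formula"
begin

text \<open>
  Put \<open>f z = G (ia; iz)\<close> and \<open>g z = G (1 + ia; iz)\<close>. Kummer's transformation gives
  \<open>g z = cnj (f (cnj z))\<close>, so both functions in (i) equal \<open>f\<close>, and the contiguous relations become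
  \<open>z f' = ia (g - f) - iz/2 f\<close>, \<open>z g' = ia (g - f) + iz/2 g\<close>. Along the ray \<open>t \<mapsto> t z\<close> the difference
  \<open>|f|\<^sup>2 - |g|\<^sup>2\<close>, which vanishes at \<open>t = 0\<close>, has derivative \<open>Im z (|f|\<^sup>2 + |g|\<^sup>2)\<close>; a Gronwall estimate
  shows that \<open>|f|\<^sup>2 + |g|\<^sup>2\<close> has no zero. Hence \<open>|g| < |f|\<close> in the upper half plane, and on the real line
  \<open>|g| = |f| \<noteq> 0\<close>.

  On the real line \<open>f\<close> has argument \<open>y - x/2\<close>, so \<open>g / f = cis (x - 2 y)\<close> and the equation for \<open>f\<close>
  turns into the initial value problem. A local logarithm of the hypergeometric function makes \<open>y\<close>
  real-analytic; the sign and monotonicity claims follow from the initial value problem alone.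
  With \<open>\<theta> = x - 2 y\<close>, the function \<open>p = x \<theta>' = x + 2 a (1 - cos \<theta>)\<close> satisfies
  \<open>p' = 1 + 2 a sin \<theta> \<theta>'\<close>; thus \<open>p' = 1\<close> at \<open>0\<close> and at every other zero of \<open>p\<close>, so \<open>p\<close> cannot return to
  \<open>0\<close> and \<open>\<theta>' > 0\<close> away from the origin.
\<close>

section \<open>Kummer's transformation and contiguity\<close>

text \<open>Turns the factorial quotient in a Cauchy product into a Pochhammer symbol, by comparing
  two expressions for the binomial coefficient.\<close>

lemma pochhammer_minus_of_nat:
  assumes "k \<le> n"
  shows "pochhammer (- of_nat n :: complex) k = (- 1) ^ k * (fact n / fact (n - k))"
proof -
  have "(fact n / (fact k * fact (n - k)) :: complex) = of_nat n gchoose k"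
    using assms by (metis binomial_fact binomial_gbinomial)
  also have "\<dots> = (- 1) ^ k * pochhammer (- of_nat n) k / fact k"
    by (rule gbinomial_pochhammer)
  finally have "(fact n / fact (n - k) :: complex) = (- 1) ^ k * pochhammer (- of_nat n) k"
    by (simp add: field_simps)
  hence "(- 1) ^ k * (fact n / fact (n - k) :: complex)
      = ((- 1) ^ k * (- 1) ^ k) * pochhammer (- of_nat n) k"
    by (simp only: mult.assoc)
  thus ?thesis
    by (simp add: power_mult_distrib [symmetric])
qed

lemma hyp1F1_1_sums: "(\<lambda>k. pochhammer a k / (fact k)\<^sup>2 * \<zeta> ^ k) sums hyp1F1_1 a \<zeta>"
  unfolding hyp1F1_1_def by (rule summable_sums [OF summable_hyp1F1_1])

text \<open>The series converges at \<open>norm \<zeta> + 1\<close>, a point of larger modulus,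
  hence absolutely at \<open>\<zeta>\<close>. Cauchy products require this.\<close>

lemma summable_norm_hyp1F1_1:
  fixes a \<zeta> :: complex
  shows "summable (\<lambda>k. norm (pochhammer a k / (fact k)\<^sup>2 * \<zeta> ^ k))"
proof (rule powser_insidea [where f = "\<lambda>k. pochhammer a k / (fact k)\<^sup>2 :: complex"])
  show "summable (\<lambda>k. pochhammer a k / (fact k)\<^sup>2 * (of_real (norm \<zeta> + 1)) ^ k)"
    by (rule summable_hyp1F1_1)
qed (simp del: of_real_add)

text \<open>Multiply the series for \<open>1 - a\<close> at \<open>- \<zeta>\<close> by the
  exponential series: each coefficient of the Cauchy product is a terminating Chu-Vandermonde
  sum.\<close>

lemma hyp1F1_1_Kummer: "hyp1F1_1 a \<zeta> = exp \<zeta> * hyp1F1_1 (1 - a) (- \<zeta>)"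
proof -
  have "(\<lambda>n. \<Sum>k\<le>n. (pochhammer (1 - a) k / (fact k)\<^sup>2 * (- \<zeta>) ^ k) * (\<zeta> ^ (n - k) /\<^sub>R fact (n - k)))
      sums (hyp1F1_1 (1 - a) (- \<zeta>) * exp \<zeta>)"
    unfolding hyp1F1_1_def exp_def
    by (rule Cauchy_product_sums [OF summable_norm_hyp1F1_1 summable_norm_exp])
  moreover have "(\<Sum>k\<le>n. (pochhammer (1 - a) k / (fact k)\<^sup>2 * (- \<zeta>) ^ k) * (\<zeta> ^ (n - k) /\<^sub>R fact (n - k)))
      = pochhammer a n / (fact n)\<^sup>2 * \<zeta> ^ n" for n
  proof -
    have "(\<Sum>k\<le>n. (pochhammer (1 - a) k / (fact k)\<^sup>2 * (- \<zeta>) ^ k) * (\<zeta> ^ (n - k) /\<^sub>R fact (n - k)))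
      = (\<Sum>k\<in>{0..n}. (pochhammer (1 - a) k * pochhammer (- of_nat n) k)
          / (of_nat (fact k) * pochhammer 1 k)) * \<zeta> ^ n / fact n"
      unfolding sum_distrib_right sum_divide_distrib
    proof (rule sum.cong)
      fix k assume "k \<in> {0..n}"
      hence k: "k \<le> n" by simp
      have "(- \<zeta>) ^ k * \<zeta> ^ (n - k) = (- 1) ^ k * \<zeta> ^ n"
        using k by (simp add: power_minus [of \<zeta>] power_add [symmetric] mult.assoc)
      thus "(pochhammer (1 - a) k / (fact k)\<^sup>2 * (- \<zeta>) ^ k) * (\<zeta> ^ (n - k) /\<^sub>R fact (n - k))
        = (pochhammer (1 - a) k * pochhammer (- of_nat n) k)
          / (of_nat (fact k) * pochhammer 1 k) * \<zeta> ^ n / fact n"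
        by (simp add: pochhammer_minus_of_nat [OF k] pochhammer_fact [symmetric] scaleR_conv_of_real
            power2_eq_square field_simps)
    qed auto
    also have "(\<Sum>k\<in>{0..n}. (pochhammer (1 - a) k * pochhammer (- of_nat n) k)
          / (of_nat (fact k) * pochhammer 1 k)) = pochhammer (1 - (1 - a)) n / pochhammer 1 n"
    proof (rule Vandermonde_pochhammer, rule ballI)
      show "1 \<noteq> - (of_nat i :: complex)" for i
        by (metis add.commute add.right_inverse of_nat_Suc of_nat_neq_0)
    qed
    finally show ?thesis
      by (simp add: pochhammer_fact [symmetric] power2_eq_square)
  qed
  ultimately show ?thesis
    using hyp1F1_1_sums [of a \<zeta>] sums_unique2 by (simp add: mult.commute) blast
qed

lemma cnj_hyp1F1_1: "cnj (hyp1F1_1 a \<zeta>) = hyp1F1_1 (cnj a) (cnj \<zeta>)"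
proof -
  have cnj_poch: "cnj (pochhammer a k) = pochhammer (cnj a) k" for k
    by (simp add: pochhammer_prod)
  have "(\<lambda>k. cnj (pochhammer a k / (fact k)\<^sup>2 * \<zeta> ^ k)) sums cnj (hyp1F1_1 a \<zeta>)"
    by (subst sums_cnj) (rule hyp1F1_1_sums)
  thus ?thesis
    using hyp1F1_1_sums [of "cnj a" "cnj \<zeta>"] by (simp add: cnj_poch sums_unique2)
qed

lemma hyp1F1_1_0 [simp]: "hyp1F1_1 a 0 = 1"
proof -
  have "(\<lambda>k. pochhammer a k / (fact k)\<^sup>2 * 0 ^ k) sums (pochhammer a 0 / (fact 0)\<^sup>2)"
    by (rule powser_sums_zero)
  thus ?thesis
    using hyp1F1_1_sums [of a 0] sums_unique2 by force
qed

text \<open>The factor \<open>\<zeta>\<close> weights the \<open>n\<close>-th coefficient by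
  \<open>n\<close>, and \<open>n (a)_n = a ((a+1)_n - (a)_n)\<close>. Keeping the factor on the left
  makes the relation meaningful at \<open>\<zeta> = 0\<close> too.\<close>

lemma hyp1F1_1_has_derivative:
  obtains D where "(hyp1F1_1 a has_field_derivative D) (at \<zeta>)"
    and "\<zeta> * D = a * (hyp1F1_1 (a + 1) \<zeta> - hyp1F1_1 a \<zeta>)"
proof
  define c where "c = (\<lambda>k. pochhammer a k / (fact k)\<^sup>2 :: complex)"
  define D where "D = (\<Sum>n. diffs c n * \<zeta> ^ n)"
  have sm: "summable (\<lambda>n. c n * y ^ n)" for y
    unfolding c_def by (rule summable_hyp1F1_1)
  show "(hyp1F1_1 a has_field_derivative D) (at \<zeta>)"
    using termdiffs_strong_converges_everywhere [OF sm, of \<zeta>]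
    unfolding D_def c_def hyp1F1_1_def [abs_def] .
  \<comment> \<open>The truncated exponent at \<open>n = 0\<close> is harmless, since that term
    carries the factor \<open>0\<close>.\<close>
  have "(\<lambda>n. of_nat n * c n * \<zeta> ^ (n - Suc 0)) sums D"
    unfolding D_def by (rule diffs_equiv) (rule termdiff_converges_all [OF sm])
  hence "(\<lambda>n. \<zeta> * (of_nat n * c n * \<zeta> ^ (n - Suc 0))) sums (\<zeta> * D)"
    by (rule sums_mult)
  moreover have "(\<lambda>k. a * (pochhammer (a + 1) k / (fact k)\<^sup>2 * \<zeta> ^ k - pochhammer a k / (fact k)\<^sup>2 * \<zeta> ^ k))
      sums (a * (hyp1F1_1 (a + 1) \<zeta> - hyp1F1_1 a \<zeta>))"
    by (intro sums_mult sums_diff hyp1F1_1_sums)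
  moreover have "\<zeta> * (of_nat n * c n * \<zeta> ^ (n - Suc 0))
      = a * (pochhammer (a + 1) n / (fact n)\<^sup>2 * \<zeta> ^ n - pochhammer a n / (fact n)\<^sup>2 * \<zeta> ^ n)" for n
  proof -
    have "a * pochhammer (a + 1) n = pochhammer a n * (a + of_nat n)"
      by (metis pochhammer_Suc pochhammer_rec)
    hence "a * (pochhammer (a + 1) n / (fact n)\<^sup>2 * \<zeta> ^ n - pochhammer a n / (fact n)\<^sup>2 * \<zeta> ^ n)
      = of_nat n * c n * \<zeta> ^ n"
      by (simp add: c_def right_diff_distrib mult.assoc [symmetric]) (simp add: field_simps)
    thus ?thesis
      by (cases n) (simp_all add: mult_ac)
  qed
  ultimately show "\<zeta> * D = a * (hyp1F1_1 (a + 1) \<zeta> - hyp1F1_1 a \<zeta>)"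
    using sums_unique2 by simp blast
qed

section \<open>The normalized function: reflection and derivative\<close>

text \<open>Conjugation sends the parameter \<open>1 + \<i> a\<close> to \<open>1 - \<i> a\<close>
  and the argument to \<open>- \<i> z\<close>; Kummer's transformation undoes both, and the half
  exponential splits its factor symmetrically.\<close>

lemma G_hyp_reflect: "cnj (G_hyp (1 + \<i> * of_real a) (\<i> * cnj z)) = G_hyp (\<i> * of_real a) (\<i> * z)"
proof -
  have "cnj (G_hyp (1 + \<i> * of_real a) (\<i> * cnj z))
      = hyp1F1_1 (1 - \<i> * of_real a) (- (\<i> * z)) * exp (\<i> * z / 2)"
    by (simp add: G_hyp_def cnj_hyp1F1_1 exp_cnj)
  also have "\<dots> = hyp1F1_1 (\<i> * of_real a) (\<i> * z) * exp (- (\<i> * z) / 2)"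
    by (simp add: hyp1F1_1_Kummer [of "\<i> * of_real a"] mult_exp_exp [symmetric] mult.assoc)
       (simp add: mult_exp_exp mult_ac)
  finally show ?thesis
    by (simp add: G_hyp_def)
qed

lemma G_hyp_0 [simp]: "G_hyp a 0 = 1"
  by (simp add: G_hyp_def)

lemma hyp1F1_1_eq_exp_G_hyp: "hyp1F1_1 a \<zeta> = exp (\<zeta> / 2) * G_hyp a \<zeta>"
  by (simp add: G_hyp_def exp_minus field_simps)

lemma G_hyp_has_derivative:
  obtains D where "((\<lambda>z. G_hyp a (\<i> * z)) has_field_derivative D) (at z)"
    and "z * D = a * (G_hyp (a + 1) (\<i> * z) - G_hyp a (\<i> * z)) - \<i> * z / 2 * G_hyp a (\<i> * z)"
proof -
  from hyp1F1_1_has_derivative [of a "\<i> * z"] obtain D where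
    D: "(hyp1F1_1 a has_field_derivative D) (at (\<i> * z))"
      "\<i> * z * D = a * (hyp1F1_1 (a + 1) (\<i> * z) - hyp1F1_1 a (\<i> * z))" .
  have "((\<lambda>z. hyp1F1_1 a (\<i> * z)) has_field_derivative D * \<i>) (at z)"
    by (rule DERIV_chain2 [where g = "\<lambda>z. \<i> * z", OF D(1)]) (auto intro!: derivative_eq_intros)
  hence "((\<lambda>z. G_hyp a (\<i> * z)) has_field_derivative
      D * \<i> * exp (- (\<i> * z) / 2) - \<i> / 2 * G_hyp a (\<i> * z)) (at z)"
    unfolding G_hyp_def by (auto intro!: derivative_eq_intros)
  moreover have "z * (D * \<i> * exp (- (\<i> * z) / 2) - \<i> / 2 * G_hyp a (\<i> * z))
      = (\<i> * z * D) * exp (- (\<i> * z) / 2) - \<i> * z / 2 * G_hyp a (\<i> * z)"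
    by (simp add: algebra_simps)
  moreover have "\<dots> = a * (G_hyp (a + 1) (\<i> * z) - G_hyp a (\<i> * z)) - \<i> * z / 2 * G_hyp a (\<i> * z)"
    unfolding D(2) G_hyp_def by (simp add: algebra_simps)
  ultimately show thesis
    using that by simp
qed

section \<open>Moduli in the upper half plane\<close>

lemma has_real_derivative_norm_sq:
  assumes "(\<phi> has_vector_derivative d) (at t)"
  shows "((\<lambda>t. (cmod (\<phi> t))\<^sup>2) has_real_derivative 2 * Re (cnj (\<phi> t) * d)) (at t)"
  unfolding cmod_power2
  by (rule derivative_eq_intros assms refl)+ (simp add: algebra_simps)

text \<open>Only interior derivatives enter, so the interval may start at the singular point
  \<open>0\<close> of the differential equations.\<close>

lemma deriv_nonneg_imp_le:
  fixes f :: "real \<Rightarrow> real"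
  assumes "a \<le> b" and "continuous_on {a..b} f"
    and "\<And>x. a < x \<Longrightarrow> x < b \<Longrightarrow> \<exists>d\<ge>0. (f has_real_derivative d) (at x)"
  shows "f a \<le> f b"
proof (cases "a = b")
  case False
  hence "a < b" using assms(1) by simp
  have "f differentiable (at x)" if "a < x" "x < b" for x
    using assms(3) [OF that] real_differentiable_def by blast
  from MVT [OF \<open>a < b\<close> assms(2) this] obtain l z
    where z: "a < z" "z < b" "(f has_real_derivative l) (at z)" "f b - f a = (b - a) * l"
    by blast
  from assms(3) [OF z(1,2)] have "l \<ge> 0"
    using z(3) DERIV_unique by blast
  with z(4) \<open>a < b\<close> show ?thesis
    by (metis diff_ge_0_iff_ge mult_nonneg_nonneg less_imp_le)
qed simp

section \<open>The pair \<open>f\<close>, \<open>g\<close> and its first-order system\<close>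

locale hypergeometric_pair =
  fixes a :: real
begin

definition f :: "complex \<Rightarrow> complex" where "f z = G_hyp (\<i> * of_real a) (\<i> * z)"
definition g :: "complex \<Rightarrow> complex" where "g z = G_hyp (1 + \<i> * of_real a) (\<i> * z)"

lemma f_0 [simp]: "f 0 = 1" and g_0 [simp]: "g 0 = 1"
  by (simp_all add: f_def g_def)

lemma g_eq: "g z = cnj (f (cnj z))"
  using G_hyp_reflect [of a "cnj z"] by (simp add: f_def g_def) (metis complex_cnj_cnj)

lemma f_has_derivative:
  obtains D where "(f has_field_derivative D) (at z)"
    and "z * D = \<i> * of_real a * (g z - f z) - \<i> * z / 2 * f z"
proof -
  from G_hyp_has_derivative [of "\<i> * of_real a" z] obtain D where
    "((\<lambda>z. G_hyp (\<i> * of_real a) (\<i> * z)) has_field_derivative D) (at z)"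
    "z * D = \<i> * of_real a * (G_hyp (\<i> * of_real a + 1) (\<i> * z) - G_hyp (\<i> * of_real a) (\<i> * z))
      - \<i> * z / 2 * G_hyp (\<i> * of_real a) (\<i> * z)" .
  thus thesis
    using that unfolding f_def [abs_def] g_def by (simp add: add.commute)
qed

text \<open>Conjugating the relation for \<open>f\<close> at \<open>cnj z\<close> interchanges
  \<open>f\<close> and \<open>g\<close> and flips the sign of \<open>\<i>\<close>: the difference
  term is preserved and the linear term changes sign.\<close>

lemma g_has_derivative:
  obtains D where "(g has_field_derivative D) (at z)"
    and "z * D = \<i> * of_real a * (g z - f z) + \<i> * z / 2 * g z"
proof -
  from f_has_derivative [of "cnj z"] obtain D where
    D: "(f has_field_derivative D) (at (cnj z))"
      "cnj z * D = \<i> * of_real a * (g (cnj z) - f (cnj z)) - \<i> * cnj z / 2 * f (cnj z)" .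
  have "(cnj \<circ> f \<circ> cnj has_field_derivative cnj D) (at z)"
    using has_field_derivative_cnj_cnj [OF D(1)] by simp
  moreover have "cnj \<circ> f \<circ> cnj = g"
    by (auto simp: g_eq)
  ultimately have "(g has_field_derivative cnj D) (at z)"
    by simp
  moreover have "z * cnj D = \<i> * of_real a * (g z - f z) + \<i> * z / 2 * g z"
    using arg_cong [OF D(2), of cnj] by (simp add: g_eq algebra_simps)
  ultimately show thesis
    using that by blast
qed

lemma continuous_on_f [continuous_intros]: "continuous_on S h \<Longrightarrow> continuous_on S (\<lambda>x. f (h x))"
proof (rule continuous_on_compose2 [of UNIV f])
  show "continuous_on UNIV f"
    by (meson DERIV_continuous_on f_has_derivative)
qed auto

lemma continuous_on_g [continuous_intros]: "continuous_on S h \<Longrightarrow> continuous_on S (\<lambda>x. g (h x))"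
  unfolding g_eq by (intro continuous_intros)

definition N :: "complex \<Rightarrow> real" where "N z = (cmod (f z))\<^sup>2 + (cmod (g z))\<^sup>2"
definition D :: "complex \<Rightarrow> real" where "D z = (cmod (f z))\<^sup>2 - (cmod (g z))\<^sup>2"

text \<open>Both squared moduli contain the same cross term
  \<open>- 2 a / t * Im (cnj f * g)\<close>. It cancels in \<open>D\<close> and doubles in
  \<open>N\<close>.\<close>

lemma has_derivative_on_ray:
  fixes t :: real
  assumes "t > 0"
  shows "((\<lambda>t. D (of_real t * z)) has_real_derivative Im z * N (of_real t * z)) (at t)"
    and "((\<lambda>t. N (of_real t * z)) has_real_derivative
      Im z * D (of_real t * z) - 4 * a / t * Im (cnj (f (of_real t * z)) * g (of_real t * z))) (at t)"
proof -
  define w where "w = of_real t * z"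
  obtain F where F: "(f has_field_derivative F) (at w)"
    "w * F = \<i> * of_real a * (g w - f w) - \<i> * w / 2 * f w"
    using f_has_derivative .
  obtain G where G: "(g has_field_derivative G) (at w)"
    "w * G = \<i> * of_real a * (g w - f w) + \<i> * w / 2 * g w"
    using g_has_derivative .
  have ray: "((\<lambda>t. of_real t * z) has_vector_derivative z) (at t)"
    by (auto intro!: derivative_eq_intros)
  have "((\<lambda>t. f (of_real t * z)) has_vector_derivative z * F) (at t)"
    using field_vector_diff_chain_at [OF ray F(1) [unfolded w_def]] by (simp add: o_def)
  note dF = has_real_derivative_norm_sq [OF this, folded w_def]
  have "((\<lambda>t. g (of_real t * z)) has_vector_derivative z * G) (at t)"
    using field_vector_diff_chain_at [OF ray G(1) [unfolded w_def]] by (simp add: o_def)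
  note dG = has_real_derivative_norm_sq [OF this, folded w_def]
  \<comment> \<open>Since \<open>w = t z\<close>, dividing the relation for \<open>w * F\<close> by
    \<open>t\<close> yields \<open>z * F\<close> even when \<open>z = 0\<close>.\<close>
  have zF: "z * F = (\<i> * of_real a * (g w - f w) - \<i> * w / 2 * f w) / of_real t"
  proof -
    have "z * F = w * F / of_real t" using assms by (simp add: w_def)
    thus ?thesis unfolding F(2) .
  qed
  have zG: "z * G = (\<i> * of_real a * (g w - f w) + \<i> * w / 2 * g w) / of_real t"
  proof -
    have "z * G = w * G / of_real t" using assms by (simp add: w_def)
    thus ?thesis unfolding G(2) .
  qed
  have Imw: "Im w = t * Im z" by (simp add: w_def)
  have eF: "2 * Re (cnj (f w) * (z * F)) = Im z * (cmod (f w))\<^sup>2 - 2 * a / t * Im (cnj (f w) * g w)"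
  proof -
    have "2 * Re (cnj (f w) * (\<i> * of_real a * (g w - f w) - \<i> * w / 2 * f w))
        = Im w * (cmod (f w))\<^sup>2 - 2 * a * Im (cnj (f w) * g w)"
      unfolding cmod_power2
      by (simp add: power2_eq_square algebra_simps add_divide_distrib diff_divide_distrib)
    hence "2 * Re (cnj (f w) * (z * F))
        = (Im w * (cmod (f w))\<^sup>2 - 2 * a * Im (cnj (f w) * g w)) / t"
      unfolding zF times_divide_eq_right [of "cnj (f w)"] Re_divide_of_real by simp
    thus ?thesis
      unfolding Imw using assms by (simp add: diff_divide_distrib)
  qed
  have eG: "2 * Re (cnj (g w) * (z * G)) = - Im z * (cmod (g w))\<^sup>2 - 2 * a / t * Im (cnj (f w) * g w)"
  proof -
    have "2 * Re (cnj (g w) * (\<i> * of_real a * (g w - f w) + \<i> * w / 2 * g w))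
        = - Im w * (cmod (g w))\<^sup>2 - 2 * a * Im (cnj (f w) * g w)"
      unfolding cmod_power2
      by (simp add: power2_eq_square algebra_simps add_divide_distrib diff_divide_distrib)
    hence "2 * Re (cnj (g w) * (z * G))
        = (- Im w * (cmod (g w))\<^sup>2 - 2 * a * Im (cnj (f w) * g w)) / t"
      unfolding zG times_divide_eq_right [of "cnj (g w)"] Re_divide_of_real by simp
    thus ?thesis
      unfolding Imw using assms by (simp add: diff_divide_distrib)
  qed
  show "((\<lambda>t. D (of_real t * z)) has_real_derivative Im z * N (of_real t * z)) (at t)"
    using DERIV_diff [OF dF dG] unfolding eF eG unfolding D_def N_def w_def by (simp add: algebra_simps)
  show "((\<lambda>t. N (of_real t * z)) has_real_derivative
      Im z * D (of_real t * z) - 4 * a / t * Im (cnj (f (of_real t * z)) * g (of_real t * z))) (at t)"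
    using DERIV_add [OF dF dG] unfolding eF eG unfolding D_def N_def w_def by (simp add: algebra_simps)
qed

text \<open>If \<open>N\<close> failed to be positive at \<open>z\<close>, the nondecreasing
  weighted function \<open>K\<close> would force \<open>N \<le> 0\<close> along the whole ray down
  to the origin, where \<open>N\<close> equals \<open>2\<close>.\<close>

lemma N_pos: "N z > 0"
proof (rule ccontr)
  assume "\<not> N z > 0"
  hence Nz: "N z \<le> 0" by simp
  \<comment> \<open>The constant comes from the cross term:
    \<open>\<bar>Im (cnj f * g)\<bar> \<le> N / 2\<close>, multiplied by
    \<open>4 \<bar>a\<bar> / t\<close>.\<close>
  define c where "c = 2 * \<bar>a\<bar>"
  \<comment> \<open>the integrating factor of the estimate \<open>N' \<ge> - (c / t + |z|) N\<close>\<close>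
  define K where "K t = N (of_real t * z) * (t powr c * exp (cmod z * t))" for t
  have N_le: "N (of_real t * z) \<le> 0" if t: "0 < t" "t \<le> 1" for t
  proof -
    have "K t \<le> K 1"
    proof (rule deriv_nonneg_imp_le [OF t(2)])
      show "continuous_on {t..1} K"
        unfolding K_def N_def using t by (intro continuous_intros) auto
      fix s assume "t < s" "s < 1"
      hence s: "s > 0" using t by simp
      define w where "w = of_real s * z"
      define N' where "N' = Im z * D w - 4 * a / s * Im (cnj (f w) * g w)"
      have "(K has_real_derivative N' * (s powr c * exp (cmod z * s))
          + (c * s powr (c - 1) * exp (cmod z * s) + s powr c * (exp (cmod z * s) * cmod z)) * N w) (at s)"
        unfolding K_def [abs_def]
        using has_derivative_on_ray(2) [OF s, of z] s
        by (auto intro!: derivative_eq_intros simp: N'_def w_def)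
      also have "N' * (s powr c * exp (cmod z * s))
          + (c * s powr (c - 1) * exp (cmod z * s) + s powr c * (exp (cmod z * s) * cmod z)) * N w
          = (s powr c * exp (cmod z * s)) * (N' + (c / s + cmod z) * N w)"
        using s by (simp add: powr_diff field_simps)
      finally have "(K has_real_derivative \<dots>) (at s)" .
      moreover have "N' + (c / s + cmod z) * N w \<ge> 0"
      proof -
        have "\<bar>Im z * D w\<bar> \<le> cmod z * N w"
          unfolding abs_mult
          by (rule mult_mono) (auto simp: abs_Im_le_cmod D_def N_def intro: abs_triangle_ineq4 [THEN order_trans])
        moreover have "\<bar>4 * a / s * Im (cnj (f w) * g w)\<bar> \<le> c / s * N w"
        proof -
          have "\<bar>Im (cnj (f w) * g w)\<bar> \<le> cmod (f w) * cmod (g w)"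
            using abs_Im_le_cmod [of "cnj (f w) * g w"] by (simp add: norm_mult)
          also have "\<dots> \<le> N w / 2"
            using sum_squares_bound [of "cmod (f w)" "cmod (g w)"] by (simp add: N_def)
          finally have "\<bar>4 * a / s\<bar> * \<bar>Im (cnj (f w) * g w)\<bar> \<le> \<bar>4 * a / s\<bar> * (N w / 2)"
            by (rule mult_left_mono) simp
          thus ?thesis
            using s by (simp add: c_def abs_mult)
        qed
        ultimately show ?thesis
          unfolding N'_def distrib_right by linarith
      qed
      ultimately show "\<exists>d\<ge>0. (K has_real_derivative d) (at s)"
        using s by (metis mult_nonneg_nonneg powr_ge_zero exp_ge_zero)
    qed
    also have "K 1 \<le> 0"
      using Nz by (simp add: K_def mult_nonpos_nonneg)
    finally show ?thesis
      using t unfolding K_def by (simp add: mult_le_0_iff)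
  qed
  \<comment> \<open>The estimate covers only \<open>t > 0\<close>; continuity carries it to the
    origin.\<close>
  have "((\<lambda>t. N (of_real t * z)) \<longlongrightarrow> N (of_real 0 * z)) (at_right 0)"
  proof -
    have "continuous_on UNIV (\<lambda>t::real. N (of_real t * z))"
      unfolding N_def by (intro continuous_intros)
    thus ?thesis
      by (metis UNIV_I at_within_open_NO_MATCH continuous_on_def filterlim_at_split open_UNIV)
  qed
  moreover have "\<forall>\<^sub>F t in at_right 0. N (of_real t * z) \<le> 0"
    by (auto simp: eventually_at_right_field intro!: exI [of _ 1] N_le)
  ultimately have "N (of_real 0 * z) \<le> 0"
    by (rule tendsto_upperbound) simp
  thus False
    by (simp add: N_def)
qed

text \<open>\<open>D\<close> vanishes at the origin and its derivative along the ray,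
  \<open>Im z * N\<close>, is positive.\<close>

lemma norm_g_less_norm_f:
  assumes "Im z > 0"
  shows "cmod (g z) < cmod (f z)"
proof -
  have "D (of_real 0 * z) < D (of_real 1 * z)"
  proof (rule DERIV_pos_imp_increasing_open [of 0 1 "\<lambda>t. D (of_real t * z)"])
    fix t :: real assume "0 < t"
    thus "\<exists>y. ((\<lambda>t. D (of_real t * z)) has_real_derivative y) (at t) \<and> y > 0"
      using has_derivative_on_ray(1) [of t z] N_pos assms by (meson mult_pos_pos)
  next
    show "continuous_on {0..1} (\<lambda>t::real. D (of_real t * z))"
      unfolding D_def by (intro continuous_intros)
  qed simp
  thus ?thesis
    by (simp add: D_def power_mono_iff [symmetric, of "cmod (f z)" _ 2] power_less_imp_less_base)
qed

lemma norm_g_eq_norm_f: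
  assumes "Im z = 0"
  shows "cmod (g z) = cmod (f z)"
proof -
  have "cnj z = z" using assms by (simp add: complex_eq_iff)
  thus ?thesis by (simp add: g_eq)
qed

text \<open>Above the axis a zero of \<open>f\<close> would make \<open>cmod (g z)\<close> negative;
  on the axis it would be a zero of \<open>g\<close> as well, against \<open>N_pos\<close>.\<close>

lemma f_nonzero: "Im z \<ge> 0 \<Longrightarrow> f z \<noteq> 0"
  using norm_g_less_norm_f [of z] norm_g_eq_norm_f [of z] N_pos [of z]
  by (cases "Im z = 0") (auto simp: N_def)

lemma g_nonzero: "Im z \<le> 0 \<Longrightarrow> g z \<noteq> 0"
  using f_nonzero [of "cnj z"] by (simp add: g_eq)

lemma norm_g_le_norm_f: "Im z \<ge> 0 \<Longrightarrow> cmod (g z) \<le> cmod (f z)"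
  using norm_g_less_norm_f [of z] norm_g_eq_norm_f [of z] by force

lemma f_Hermite_Biehler: "f \<in> Hermite_Biehler"
  unfolding Hermite_Biehler_def
proof (intro CollectI conjI allI impI)
  show "f holomorphic_on UNIV"
    by (meson f_has_derivative holomorphic_onI field_differentiable_def field_differentiable_at_within)
  fix z assume "Im z > 0"
  thus "f z \<noteq> 0" "cmod (f (cnj z)) \<le> cmod (f z)"
    using f_nonzero [of z] norm_g_less_norm_f [of z] by (auto simp: g_eq)
qed

end

section \<open>Continuous branches of the argument\<close>

text \<open>Near \<open>x\<^sub>0\<close> the quotient of values stays close to \<open>1\<close>, so
  its principal logarithm is holomorphic; continuity of \<open>y\<close> then excludes jumps by
  multiples of \<open>2 pi\<close>.\<close>

lemma arg_branch_local:
  fixes \<Phi> :: "complex \<Rightarrow> complex" and x\<^sub>0 :: real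
  assumes hol: "\<Phi> holomorphic_on UNIV"
    and y: "is_arg_branch (\<lambda>x. \<Phi> (of_real x)) y"
    and nz: "\<Phi> (of_real x\<^sub>0) \<noteq> 0"
  obtains r where "r > 0"
    and "(\<lambda>z. Ln (\<Phi> z / \<Phi> (of_real x\<^sub>0))) holomorphic_on ball (of_real x\<^sub>0) r"
    and "\<And>x. \<bar>x - x\<^sub>0\<bar> < r \<Longrightarrow> y x = y x\<^sub>0 + Im (Ln (\<Phi> (of_real x) / \<Phi> (of_real x\<^sub>0)))"
proof -
  define q where "q z = \<Phi> z / \<Phi> (of_real x\<^sub>0)" for z
  have "continuous_on UNIV q"
    unfolding q_def using holomorphic_on_imp_continuous_on [OF hol] nz by (intro continuous_intros) auto
  hence "isCont q (of_real x\<^sub>0)"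
    by (simp add: continuous_on_eq_continuous_at)
  moreover have "q (of_real x\<^sub>0) = 1"
    using nz by (simp add: q_def)
  \<comment> \<open>The unit disc about \<open>1\<close> misses the branch cut of
    \<open>Ln\<close>.\<close>
  ultimately obtain r1 where r1: "r1 > 0" "\<And>z. dist z (of_real x\<^sub>0) < r1 \<Longrightarrow> dist (q z) 1 < 1"
    unfolding continuous_at_eps_delta by (metis zero_less_one)
  have "isCont y x\<^sub>0"
    using y by (simp add: is_arg_branch_def continuous_on_eq_continuous_at)
  \<comment> \<open>The bound \<open>pi\<close> keeps the increment of \<open>y\<close> in the
    principal strip, as \<open>Ln_unique\<close> demands.\<close>
  then obtain r2 where r2: "r2 > 0" "\<And>x. dist x x\<^sub>0 < r2 \<Longrightarrow> dist (y x) (y x\<^sub>0) < pi"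
    unfolding continuous_at_eps_delta using pi_gt_zero by metis
  show thesis
  proof
    show "min r1 r2 > 0"
      using r1(1) r2(1) by simp
    have "q z \<notin> \<real>\<^sub>\<le>\<^sub>0" if "z \<in> ball (of_real x\<^sub>0) r1" for z
    proof
      assume "q z \<in> \<real>\<^sub>\<le>\<^sub>0"
      hence "Re (1 - q z) \<ge> 1"
        by (auto simp: complex_nonpos_Reals_iff)
      moreover have "cmod (1 - q z) < 1"
        using r1(2) [of z] that by (simp add: dist_norm norm_minus_commute)
      ultimately show False
        using complex_Re_le_cmod [of "1 - q z"] by linarith
    qed
    moreover have "q holomorphic_on ball (of_real x\<^sub>0) (min r1 r2)"
      unfolding q_def using nz by (intro holomorphic_intros holomorphic_on_subset [OF hol]) auto
    ultimately show "(\<lambda>z. Ln (\<Phi> z / \<Phi> (of_real x\<^sub>0))) holomorphic_on ball (of_real x\<^sub>0) (min r1 r2)"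
      unfolding q_def [symmetric] by (intro holomorphic_on_Ln') auto
  next
    fix x assume x: "\<bar>x - x\<^sub>0\<bar> < min r1 r2"
    have "dist (of_real x) (of_real x\<^sub>0 :: complex) < r1"
      using x by (simp add: dist_real_def)
    hence qx: "q (of_real x) \<noteq> 0"
      using r1(2) [of "of_real x"] by (auto simp: dist_norm)
    hence \<Phi>x: "\<Phi> (of_real x) \<noteq> 0"
      by (auto simp: q_def)
    define m where "m = cmod (\<Phi> (of_real x)) / cmod (\<Phi> (of_real x\<^sub>0))"
    have m: "m > 0" using nz \<Phi>x by (simp add: m_def)
    have rc: "\<Phi> (of_real u) = rcis (cmod (\<Phi> (of_real u))) (y u)" for u
      using y by (simp add: is_arg_branch_def)
    have "q (of_real x) = rcis m (y x - y x\<^sub>0)"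
      unfolding q_def m_def by (subst rc, subst (2) rc) (simp add: rcis_divide)
    also have "\<dots> = exp (of_real (ln m) + \<i> * of_real (y x - y x\<^sub>0))"
      using m by (simp add: rcis_def cis_conv_exp exp_add exp_of_real)
    finally have "Ln (q (of_real x)) = of_real (ln m) + \<i> * of_real (y x - y x\<^sub>0)"
      using r2(2) [of x] x by (intro Ln_unique) (auto simp: dist_real_def)
    thus "y x = y x\<^sub>0 + Im (Ln (\<Phi> (of_real x) / \<Phi> (of_real x\<^sub>0)))"
      by (simp add: q_def)
  qed
qed

lemma arg_branch_has_derivative:
  assumes hol: "\<Phi> holomorphic_on UNIV"
    and y: "is_arg_branch (\<lambda>x. \<Phi> (of_real x)) y"
    and nz: "\<Phi> (of_real x) \<noteq> 0"
    and D: "(\<Phi> has_field_derivative D) (at (of_real x))"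
  shows "(y has_real_derivative Im (D / \<Phi> (of_real x))) (at x)"
proof -
  obtain r where r: "r > 0"
    "\<And>u. \<bar>u - x\<bar> < r \<Longrightarrow> y u = y x + Im (Ln (\<Phi> (of_real u) / \<Phi> (of_real x)))"
    using arg_branch_local [OF hol y nz] by metis
  have "((\<lambda>z. Ln (\<Phi> z / \<Phi> (of_real x))) has_field_derivative D / \<Phi> (of_real x)) (at (of_real x))"
    using nz by (auto intro!: derivative_eq_intros D)
  from DERIV_add [OF DERIV_const [of "y x"] has_field_derivative_Im [OF has_vector_derivative_real_field [OF this]]]
  have "((\<lambda>u. y x + Im (Ln (\<Phi> (of_real u) / \<Phi> (of_real x)))) has_real_derivative
      Im (D / \<Phi> (of_real x))) (at x)"
    by simp
  thus ?thesis
  proof (rule has_field_derivative_transform_within [OF _ r(1)])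
    show "\<And>u. dist u x < r \<Longrightarrow> y x + Im (Ln (\<Phi> (of_real u) / \<Phi> (of_real x))) = y u"
      unfolding dist_real_def by (rule r(2) [symmetric])
  qed simp
qed

text \<open>Both branches have the derivative \<open>Im (D / \<Phi>)\<close> and the value
  \<open>0\<close> at \<open>0\<close>, so their difference is constant.\<close>

lemma arg_branch_unique:
  assumes hol: "\<Phi> holomorphic_on UNIV"
    and nz: "\<And>x::real. \<Phi> (of_real x) \<noteq> 0"
    and y: "is_arg_branch (\<lambda>x. \<Phi> (of_real x)) y" "is_arg_branch (\<lambda>x. \<Phi> (of_real x)) y'"
  shows "y = y'"
proof
  fix x
  have "\<forall>x. ((\<lambda>x. y x - y' x) has_real_derivative 0) (at x)"
  proof
    fix x :: real
    obtain D where "(\<Phi> has_field_derivative D) (at (of_real x))"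
      using hol by (metis UNIV_I field_differentiable_def holomorphic_on_def at_within_open open_UNIV)
    from DERIV_diff [OF arg_branch_has_derivative [OF hol y(1) nz this] arg_branch_has_derivative [OF hol y(2) nz this]]
    show "((\<lambda>x. y x - y' x) has_real_derivative 0) (at x)" by simp
  qed
  from DERIV_isconst_all [OF this, of x 0] show "y x = y' x"
    using y by (simp add: is_arg_branch_def)
qed

text \<open>The line is contractible, so a zero-free function on it has a continuous logarithm
  \<open>L\<close>. Subtracting \<open>L 0\<close> normalizes the argument and leaves the
  exponential unchanged, as \<open>\<phi> 0 = 1\<close>.\<close>

lemma arg_branch_exists:
  assumes cont: "continuous_on UNIV (\<phi> :: real \<Rightarrow> complex)"
    and nz: "\<And>x. \<phi> x \<noteq> 0" and "\<phi> 0 = 1"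
  shows "\<exists>y. is_arg_branch \<phi> y"
proof -
  obtain L where L: "continuous_on UNIV L" "\<And>x. \<phi> x = exp (L x)"
    using continuous_logarithm_on_contractible [OF cont convex_imp_contractible] nz
    by (metis UNIV_I convex_UNIV)
  have "is_arg_branch \<phi> (\<lambda>x. Im (L x - L 0))"
    unfolding is_arg_branch_def
  proof (intro conjI allI)
    show "continuous_on UNIV (\<lambda>x. Im (L x - L 0))"
      by (intro continuous_intros L(1))
    fix x
    have *: "\<phi> x = exp (L x - L 0)"
      using \<open>\<phi> 0 = 1\<close> L(2) [of 0] L(2) [of x] by (simp add: exp_diff)
    show "\<phi> x = rcis (cmod (\<phi> x)) (Im (L x - L 0))"
      unfolding rcis_def * norm_exp_eq_Re by (rule exp_eq_polar)
  qed simp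
  thus ?thesis by blast
qed

text \<open>The imaginary parts of the Taylor coefficients of the local logarithm are those of
  \<open>y\<close>, apart from the constant \<open>y x\<close> added in degree zero.\<close>

lemma arg_branch_real_analytic:
  assumes hol: "\<Phi> holomorphic_on UNIV"
    and nz: "\<And>x::real. \<Phi> (of_real x) \<noteq> 0"
    and y: "is_arg_branch (\<lambda>x. \<Phi> (of_real x)) y"
  shows "real_analytic_on y UNIV"
  unfolding real_analytic_on_def
proof
  fix x
  define L where "L z = Ln (\<Phi> z / \<Phi> (of_real x))" for z
  obtain r where r: "r > 0" "L holomorphic_on ball (of_real x) r"
    "\<And>u. \<bar>u - x\<bar> < r \<Longrightarrow> y u = y x + Im (L (of_real u))"
    unfolding L_def using arg_branch_local [OF hol y nz] by metis
  define c where "c n = (deriv ^^ n) L (of_real x) / fact n" for n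
  define b where "b n = Im (c n) + (if n = 0 then y x else 0)" for n
  have "(\<lambda>n. b n * h ^ n) sums y (x + h)" if h: "\<bar>h\<bar> < r" for h
  proof -
    have "(\<lambda>n. c n * (of_real (x + h) - of_real x) ^ n) sums L (of_real (x + h))"
      unfolding c_def by (rule holomorphic_power_series [OF r(2)]) (use h in \<open>simp add: dist_norm\<close>)
    hence "(\<lambda>n. c n * of_real (h ^ n)) sums L (of_real (x + h))"
      by simp
    hence "(\<lambda>n. Im (c n * of_real (h ^ n))) sums Im (L (of_real (x + h)))"
      by (rule sums_Im)
    moreover have "(\<lambda>n. (if n = 0 then y x else 0) * h ^ n) sums y x"
    proof -
      have "(\<lambda>n. (if n = 0 then y x else 0) * h ^ n) = (\<lambda>n. if n = 0 then y x * h ^ n else 0)"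
        by auto
      thus ?thesis
        using sums_single [of 0 "\<lambda>n. y x * h ^ n"] by simp
    qed
    ultimately have "(\<lambda>n. Im (c n * of_real (h ^ n)) + (if n = 0 then y x else 0) * h ^ n)
        sums (Im (L (of_real (x + h))) + y x)"
      by (rule sums_add)
    moreover have "Im (c n * of_real (h ^ n)) + (if n = 0 then y x else 0) * h ^ n = b n * h ^ n" for n
      by (simp add: b_def)
    moreover have "Im (L (of_real (x + h))) + y x = y (x + h)"
      using r(3) [of "x + h"] h by simp
    ultimately show ?thesis by simp
  qed
  with r(1) show "\<exists>r>0. \<exists>c. \<forall>h. \<bar>h\<bar> < r \<longrightarrow> (\<lambda>n. c n * h ^ n) sums y (x + h)"
    by blast
qed

lemma real_analytic_on_minus:
  assumes "real_analytic_on f S"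
  shows "real_analytic_on (\<lambda>x. - f x) S"
  unfolding real_analytic_on_def
proof
  fix x assume "x \<in> S"
  then obtain r c where "r > 0" and c: "\<And>h. \<bar>h\<bar> < r \<Longrightarrow> (\<lambda>n. c n * h ^ n) sums f (x + h)"
    using assms unfolding real_analytic_on_def by blast
  moreover have "(\<lambda>n. - c n * h ^ n) sums - f (x + h)" if "\<bar>h\<bar> < r" for h
    using sums_minus [OF c [OF that]] by simp
  ultimately show "\<exists>r>0. \<exists>c. \<forall>h. \<bar>h\<bar> < r \<longrightarrow> (\<lambda>n. c n * h ^ n) sums - f (x + h)"
    by (intro exI [of _ r] exI [of _ "\<lambda>n. - c n"] conjI allI impI)
qed

section \<open>The argument of the hypergeometric function on the real line\<close>

context hypergeometric_pair
begin

definition \<Phi> :: "complex \<Rightarrow> complex" where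
  "\<Phi> z = hyp1F1_1 (\<i> * of_real a) (\<i> * z)"

lemma \<Phi>_eq: "\<Phi> z = exp (\<i> * z / 2) * f z"
  by (simp add: \<Phi>_def f_def hyp1F1_1_eq_exp_G_hyp)

text \<open>Undoing the half-exponential normalization removes the term
  \<open>- \<i> * z / 2 * f z\<close>, so only the difference \<open>g - f\<close> remains.\<close>

lemma \<Phi>_has_derivative:
  obtains F where "(\<Phi> has_field_derivative F) (at z)"
    and "z * F = \<i> * of_real a * (g z - f z) * exp (\<i> * z / 2)"
proof -
  obtain F where F: "(f has_field_derivative F) (at z)"
    "z * F = \<i> * of_real a * (g z - f z) - \<i> * z / 2 * f z"
    using f_has_derivative .
  have "(\<Phi> has_field_derivative (F + \<i> / 2 * f z) * exp (\<i> * z / 2)) (at z)"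
    unfolding \<Phi>_eq [abs_def] by (auto intro!: derivative_eq_intros F(1) simp: algebra_simps)
  moreover have "z * ((F + \<i> / 2 * f z) * exp (\<i> * z / 2))
      = (z * F + \<i> * z / 2 * f z) * exp (\<i> * z / 2)"
    by (simp add: algebra_simps)
  ultimately show thesis
    using that unfolding F(2) by simp
qed

lemma \<Phi>_holomorphic: "\<Phi> holomorphic_on UNIV"
  by (meson \<Phi>_has_derivative holomorphic_onI field_differentiable_def field_differentiable_at_within)

lemma \<Phi>_nonzero: "Im z \<ge> 0 \<Longrightarrow> \<Phi> z \<noteq> 0"
  by (simp add: \<Phi>_eq f_nonzero)

text \<open>The relation for \<open>\<Phi>\<close> divided by \<open>\<Phi>\<close> reads
  \<open>x F / \<Phi> = \<i> a (g / f - 1)\<close>; the equation is its imaginary part.\<close>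

lemma arg_branch_solves_ivp:
  assumes y: "is_arg_branch (\<lambda>x. \<Phi> (of_real x)) y"
  shows "solves_ivp a y"
  unfolding solves_ivp_def
proof (intro conjI allI)
  show "y 0 = 0"
    using y by (simp add: is_arg_branch_def)
  fix x :: real
  obtain F where F: "(\<Phi> has_field_derivative F) (at (of_real x))"
    "of_real x * F = \<i> * of_real a * (g (of_real x) - f (of_real x)) * exp (\<i> * of_real x / 2)"
    using \<Phi>_has_derivative .
  have dy: "(y has_real_derivative Im (F / \<Phi> (of_real x))) (at x)"
    using arg_branch_has_derivative [OF \<Phi>_holomorphic y _ F(1)] \<Phi>_nonzero by simp
  thus "y differentiable at x"
    using real_differentiable_def by blast
  have fx: "f (of_real x) \<noteq> 0"
    by (simp add: f_nonzero)
  have f_polar: "f (of_real x) = rcis (cmod (f (of_real x))) (y x - x / 2)"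
  proof -
    have "f (of_real x) = cis (- x / 2) * \<Phi> (of_real x)"
      by (simp add: \<Phi>_eq cis_conv_exp mult.assoc [symmetric] exp_add [symmetric])
    also have "\<Phi> (of_real x) = rcis (cmod (\<Phi> (of_real x))) (y x)"
      using y by (simp add: is_arg_branch_def)
    also have "cmod (\<Phi> (of_real x)) = cmod (f (of_real x))"
      by (simp add: \<Phi>_eq norm_mult)
    finally show ?thesis
      by (simp add: rcis_def cis_mult mult.left_commute)
  qed
  \<comment> \<open>On the real line \<open>g\<close> is the conjugate of \<open>f\<close>, so the
    quotient doubles the negated argument of \<open>f\<close>.\<close>
  have "g (of_real x) / f (of_real x) = cis (x - 2 * y x)"
  proof -
    have "g (of_real x) = rcis (cmod (f (of_real x))) (- (y x - x / 2))"
      unfolding g_eq complex_cnj_complex_of_real by (subst f_polar) (simp add: rcis_def cis_cnj)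
    from arg_cong2 [where f = "(/)", OF this f_polar]
    have "g (of_real x) / f (of_real x) = rcis 1 (- (y x - x / 2) - (y x - x / 2))"
      using fx by (simp add: rcis_divide)
    moreover have "- (y x - x / 2) - (y x - x / 2) = x - 2 * y x"
      by simp
    ultimately show ?thesis
      by (simp add: rcis_def)
  qed
  hence "of_real x * (F / \<Phi> (of_real x)) = \<i> * of_real a * (cis (x - 2 * y x) - 1)"
    using fx unfolding \<Phi>_eq times_divide_eq_right F(2) by (simp add: field_simps)
  hence "Im (of_real x * (F / \<Phi> (of_real x))) = a * (cos (x - 2 * y x) - 1)"
    by simp
  moreover have "Im (of_real x * u) = x * Im u" for u
    by simp
  ultimately have "x * Im (F / \<Phi> (of_real x)) = a * (cos (x - 2 * y x) - 1)"
    by metis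
  thus "x * deriv y x = a * (cos (x - 2 * y x) - 1)"
    using DERIV_imp_deriv [OF dy] by simp
qed

end

section \<open>The initial value problem\<close>

lemma solves_ivp_equation:
  "solves_ivp a w \<Longrightarrow> x * deriv w x = a * (cos (x - 2 * w x) - 1)"
  by (simp add: solves_ivp_def)

lemma solves_ivp_has_derivative:
  "solves_ivp a w \<Longrightarrow> (w has_real_derivative deriv w x) (at x)"
  by (simp add: solves_ivp_def DERIV_deriv_iff_real_differentiable)

lemma solves_ivp_continuous: "solves_ivp a w \<Longrightarrow> continuous_on S w"
  by (meson DERIV_isCont continuous_at_imp_continuous_on solves_ivp_has_derivative)

text \<open>A point reflection of the graph changes the sign of \<open>a\<close>. Statements on the
  negative semiaxis thus reduce to the positive one.\<close>

lemma solves_ivp_reflect: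
  assumes "solves_ivp a w"
  shows "solves_ivp (- a) (\<lambda>x. - w (- x))" and "deriv (\<lambda>x. - w (- x)) x = deriv w (- x)"
proof -
  have d: "((\<lambda>x. - w (- x)) has_real_derivative deriv w (- x)) (at x)" for x
    using DERIV_minus [OF DERIV_mirror [THEN iffD1, OF solves_ivp_has_derivative [OF assms]]] by simp
  show e: "deriv (\<lambda>x. - w (- x)) x = deriv w (- x)" for x
    using d by (rule DERIV_imp_deriv)
  show "solves_ivp (- a) (\<lambda>x. - w (- x))"
    unfolding solves_ivp_def e
  proof (intro conjI allI)
    show "- w (- 0) = 0" using assms by (simp add: solves_ivp_def)
    show "(\<lambda>x. - w (- x)) differentiable at x" for x
      using d real_differentiable_def by blast
    fix x
    have "- x * deriv w (- x) = a * (cos (- x - 2 * w (- x)) - 1)"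
      by (rule solves_ivp_equation [OF assms])
    moreover have "cos (- x - 2 * w (- x)) = cos (x - 2 * - w (- x))"
    proof -
      have "- x - 2 * w (- x) = - (x - 2 * - w (- x))" by simp
      thus ?thesis by (simp only: cos_minus)
    qed
    ultimately show "x * deriv w (- x) = - a * (cos (x - 2 * - w (- x)) - 1)"
      by (simp add: algebra_simps)
  qed
qed

section \<open>Monotonicity of the phase\<close>

text \<open>A first-zero argument: \<open>p\<close> is positive just right of \<open>0\<close>, and
  at a smallest later zero its slope would be \<open>1\<close>, making it negative just before and
  so forcing a still earlier zero.\<close>

lemma phase_derivative_pos_right:
  assumes w: "solves_ivp a w" and "x > 0"
  shows "1 - 2 * deriv w x > 0"
proof (rule ccontr)
  assume neg: "\<not> 1 - 2 * deriv w x > 0"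
  define \<theta> where "\<theta> u = u - 2 * w u" for u
  define \<theta>' where "\<theta>' u = 1 - 2 * deriv w u" for u
  \<comment> \<open>This formula for \<open>u * \<theta>' u\<close> is differentiable with no appeal
    to a second derivative of \<open>w\<close>.\<close>
  define p where "p u = u + 2 * a * (1 - cos (\<theta> u))" for u
  have p: "p u = u * \<theta>' u" for u
  proof -
    have "u * deriv w u = a * (cos (\<theta> u) - 1)"
      unfolding \<theta>_def by (rule solves_ivp_equation [OF w])
    thus ?thesis by (simp add: p_def \<theta>'_def algebra_simps)
  qed
  have d\<theta>: "(\<theta> has_real_derivative \<theta>' u) (at u)" for u
    unfolding \<theta>_def \<theta>'_def by (auto intro!: derivative_eq_intros solves_ivp_has_derivative [OF w])
  have dp: "(p has_real_derivative 1 + 2 * a * (sin (\<theta> u) * \<theta>' u)) (at u)" for u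
    unfolding p_def by (auto intro!: derivative_eq_intros d\<theta>)
  have cont: "continuous_on S p" for S
    by (meson DERIV_isCont continuous_at_imp_continuous_on dp)
  have "\<theta> 0 = 0" "p 0 = 0"
    using w by (auto simp: solves_ivp_def \<theta>_def p)
  then obtain d where d: "d > 0" "\<And>h. 0 < h \<Longrightarrow> h < d \<Longrightarrow> p h > 0"
    using DERIV_pos_inc_right [OF dp [of 0]] by auto
  \<comment> \<open>Starting at \<open>t\<close> separates \<open>Z\<close> from the zero of
    \<open>p\<close> at the origin, so that a least element exists beyond it.\<close>
  define t where "t = min d x / 2"
  have t: "0 < t" "t < x" "p t > 0"
    using d \<open>x > 0\<close> by (auto simp: t_def)
  define Z where "Z = {u \<in> {t..x}. p u = 0}"
  have "p x \<le> 0"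
    using neg \<open>x > 0\<close> unfolding p \<theta>'_def by (simp add: mult_le_0_iff)
  hence "Z \<noteq> {}"
    using IVT2' [OF _ _ _ cont, of x 0 t] t unfolding Z_def by force
  moreover have "compact Z"
  proof -
    have "closed Z"
      unfolding Z_def by (rule continuous_closed_preimage_constant [OF cont]) simp
    moreover have "Z \<subseteq> {t..x}" by (auto simp: Z_def)
    ultimately show ?thesis
      using compact_Int_closed [OF compact_Icc, of Z t x] by (simp add: Int_absorb1)
  qed
  ultimately obtain c where c: "c \<in> Z" "\<And>u. u \<in> Z \<Longrightarrow> c \<le> u"
    using compact_attains_inf by metis
  hence "c > t" "c \<le> x" "p c = 0"
    using t unfolding Z_def by (auto simp: less_le)
  hence "\<theta>' c = 0"
    using p [of c] t by simp
  then obtain e where e: "e > 0" "\<And>h. 0 < h \<Longrightarrow> h < e \<Longrightarrow> p (c - h) < 0"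
    using DERIV_pos_inc_left [OF dp [of c]] \<open>p c = 0\<close> by auto
  \<comment> \<open>Halving keeps \<open>c - h\<close> to the right of \<open>t\<close> and inside
    the range where \<open>p\<close> is negative.\<close>
  define h where "h = min e (c - t) / 2"
  have h: "0 < h" "h < e" "t \<le> c - h"
    using e(1) \<open>c > t\<close> by (auto simp: h_def min_def field_simps)
  obtain u where "t \<le> u" "u \<le> c - h" "p u = 0"
    using IVT2' [OF _ _ h(3) cont, of 0] e(2) [OF h(1,2)] t(3) by force
  moreover from this have "u \<in> Z"
    using \<open>c \<le> x\<close> h by (simp add: Z_def)
  ultimately show False
    using c(2) [of u] h by simp
qed

lemma phase_derivative_pos:
  assumes w: "solves_ivp a w" and "x \<noteq> 0"
  shows "1 - 2 * deriv w x > 0"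
proof (cases "x > 0")
  case False
  hence "- x > 0" using assms(2) by simp
  from phase_derivative_pos_right [OF solves_ivp_reflect(1) [OF w] this]
  show ?thesis by (simp add: solves_ivp_reflect(2) [OF w])
qed (rule phase_derivative_pos_right [OF w])

text \<open>The derivative is known to be positive only away from \<open>0\<close>, so an interval
  straddling the origin is split there.\<close>

lemma phase_strict_mono:
  assumes w: "solves_ivp a w"
  shows "strict_mono (\<lambda>x. x - 2 * w x)"
proof (rule strict_monoI)
  define \<theta> where "\<theta> x = x - 2 * w x" for x
  have *: "\<theta> u < \<theta> v" if "u < v" "0 \<le> u \<or> v \<le> 0" for u v
  proof (rule DERIV_pos_imp_increasing_open [OF \<open>u < v\<close>])
    fix x assume "u < x" "x < v"
    with that have "x \<noteq> 0" by auto
    have "(\<theta> has_real_derivative 1 - 2 * deriv w x) (at x)"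
      unfolding \<theta>_def by (auto intro!: derivative_eq_intros solves_ivp_has_derivative [OF w])
    thus "\<exists>y. (\<theta> has_real_derivative y) (at x) \<and> 0 < y"
      using phase_derivative_pos [OF w \<open>x \<noteq> 0\<close>] by blast
  next
    show "continuous_on {u..v} \<theta>"
      unfolding \<theta>_def by (intro continuous_intros solves_ivp_continuous [OF w])
  qed
  fix u v :: real assume "u < v"
  consider "0 \<le> u \<or> v \<le> 0" | "u < 0" "0 < v" by linarith
  hence "\<theta> u < \<theta> v"
    using * [of u v] * [of u 0] * [of 0 v] \<open>u < v\<close> by cases auto
  thus "u - 2 * w u < v - 2 * w v" by (simp add: \<theta>_def)
qed

section \<open>Sign, monotonicity and uniqueness of solutions\<close>

text \<open>Multiplied by \<open>a\<close>, the equation has right-hand side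
  \<open>a\<^sup>2 (cos \<theta> - 1) \<le> 0\<close>, which gives weak monotonicity. Equality would
  make \<open>w\<close> constant on an interval and the cosine identically \<open>1\<close> there,
  although its argument moves.\<close>

lemma ivp_solution_strict_antimono_right:
  assumes w: "solves_ivp a w" and "a \<noteq> 0" "0 \<le> u" "u < v"
  shows "a * w v < a * w u"
proof (rule ccontr)
  assume "\<not> a * w v < a * w u"
  have anti: "a * w t \<le> a * w s" if "0 \<le> s" "s \<le> t" for s t
  proof -
    have "- (a * w s) \<le> - (a * w t)"
    proof (rule deriv_nonneg_imp_le [OF \<open>s \<le> t\<close>])
      show "continuous_on {s..t} (\<lambda>x. - (a * w x))"
        by (intro continuous_intros solves_ivp_continuous [OF w])
      fix x assume "s < x" "x < t"
      hence "x > 0" using \<open>0 \<le> s\<close> by simp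
      have "x * (- (a * deriv w x)) = a\<^sup>2 * (1 - cos (x - 2 * w x))"
      proof -
        have "- a * (x * deriv w x) = - a * (a * (cos (x - 2 * w x) - 1))"
          by (simp only: solves_ivp_equation [OF w])
        thus ?thesis
          by (simp add: power2_eq_square algebra_simps)
      qed
      hence "x * (- (a * deriv w x)) \<ge> 0"
        by simp
      hence "- (a * deriv w x) \<ge> 0"
        using \<open>x > 0\<close> by (simp only: zero_le_mult_iff) linarith
      moreover have "((\<lambda>x. - (a * w x)) has_real_derivative - (a * deriv w x)) (at x)"
        by (auto intro!: derivative_eq_intros solves_ivp_has_derivative [OF w])
      ultimately show "\<exists>d\<ge>0. ((\<lambda>x. - (a * w x)) has_real_derivative d) (at x)"
        by blast
    qed
    thus ?thesis by simp
  qed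
  have const: "w x = w u" if "u < x" "x < v" for x
  proof -
    have "a * w x = a * w u"
      using anti [of u x] anti [of x v] that assms \<open>\<not> a * w v < a * w u\<close> by linarith
    thus ?thesis using \<open>a \<noteq> 0\<close> by simp
  qed
  have cos1: "cos (x - 2 * w u) = 1" if x: "u < x" "x < v" for x
  proof -
    have "(w has_real_derivative 0) (at x)"
    proof (rule has_field_derivative_transform_within_open [OF DERIV_const])
      show "w u = w z" if "z \<in> {u<..<v}" for z
        using const that by simp
    qed (use x in auto)
    hence "deriv w x = 0" by (rule DERIV_imp_deriv)
    thus ?thesis
      using solves_ivp_equation [OF w, of x] \<open>a \<noteq> 0\<close> const [OF x] by simp
  qed
  \<comment> \<open>Two sample points at distance \<open>h\<close> inside the interval give
    \<open>cos h = 1\<close>, impossible for \<open>0 < h \<le> pi\<close>.\<close>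
  define h where "h = min (v - u) 1 / 3"
  have h: "0 < h" "u + 2 * h < v" "h \<le> pi"
    using \<open>u < v\<close> pi_gt3 by (auto simp: h_def min_def field_simps)
  define s where "s = u + h - 2 * w u"
  have s: "cos s = 1" "cos (s + h) = 1"
    using cos1 [of "u + h"] cos1 [of "u + 2 * h"] h by (auto simp: s_def algebra_simps)
  hence "cos h = 1"
    using cos_one_sin_zero [OF s(1)] by (simp add: cos_add)
  thus False
    using cos_monotone_0_pi [of 0 h] h by simp
qed

text \<open>
  The equation is singular at \<open>0\<close>, but \<open>cos A - cos B = O((A + B) (A - B))\<close> and \<open>A + B = O(x)\<close> by
  differentiability at \<open>0\<close>, which leaves a Lipschitz estimate for the difference of two solutions.
\<close>

lemma ivp_solution_unique_right:
  assumes w: "solves_ivp a w" and v: "solves_ivp a v" and "x > 0"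
  shows "w x = v x"
proof -
  define s where "s u = (u - 2 * w u) + (u - 2 * v u)" for u
  define \<delta> where "\<delta> u = w u - v u" for u
  define \<delta>' where "\<delta>' u = deriv w u - deriv v u" for u
  have w0: "w 0 = 0" and v0: "v 0 = 0"
    using w v by (simp_all add: solves_ivp_def)
  have ds: "(s has_real_derivative (1 - 2 * deriv w u) + (1 - 2 * deriv v u)) (at u)" for u
    unfolding s_def
    by (auto intro!: derivative_eq_intros solves_ivp_has_derivative [OF w] solves_ivp_has_derivative [OF v])
  have "s 0 = 0"
    by (simp add: s_def w0 v0)
  \<comment> \<open>Caratheodory's form of differentiability supplies a continuous extension of
    \<open>s u / u\<close> to \<open>0\<close>; compactness then bounds it on the whole
    interval.\<close>
  with ds [of 0] obtain q where q: "\<And>u. s u = q u * u" "isCont q 0"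
    unfolding CARAT_DERIV by auto
  have "isCont q u" for u
  proof (cases "u = 0")
    case False
    have cont: "isCont (\<lambda>u. s u / u) u"
      using False ds DERIV_isCont by (intro continuous_intros) auto
    have "\<forall>\<^sub>F z in nhds u. z \<noteq> 0"
      using False eventually_nhds_in_open [of "- {0}" u] by (simp add: open_Compl)
    hence "\<forall>\<^sub>F z in nhds u. s z / z = q z"
      by (rule eventually_mono) (simp add: q(1))
    from isCont_cong [THEN iffD1, OF this cont] show ?thesis .
  qed (use q in simp)
  hence "compact (q ` {0..x})"
    by (intro compact_continuous_image continuous_at_imp_continuous_on) auto
  then obtain K where K: "\<And>u. 0 \<le> u \<Longrightarrow> u \<le> x \<Longrightarrow> \<bar>q u\<bar> \<le> K"
    using compact_imp_bounded bounded_iff by (metis atLeastAtMost_iff imageI real_norm_def)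
  define C where "C = \<bar>a\<bar> * K"
  have bound: "\<bar>\<delta>' u\<bar> \<le> C * \<bar>\<delta> u\<bar>" if u: "0 < u" "u < x" for u
  proof -
    have "u * \<delta>' u = a * (cos (u - 2 * w u) - cos (u - 2 * v u))"
      unfolding \<delta>'_def right_diff_distrib [of u] solves_ivp_equation [OF w] solves_ivp_equation [OF v]
      by (simp add: algebra_simps)
    also have "\<dots> = 2 * a * sin (s u / 2) * sin (\<delta> u)"
      by (simp add: cos_diff_cos s_def \<delta>_def add_divide_distrib diff_divide_distrib)
    finally have "\<bar>u * \<delta>' u\<bar> = \<bar>2 * a * sin (s u / 2) * sin (\<delta> u)\<bar>"
      by (rule arg_cong)
    hence "u * \<bar>\<delta>' u\<bar> = 2 * \<bar>a\<bar> * \<bar>sin (s u / 2)\<bar> * \<bar>sin (\<delta> u)\<bar>"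
      using u by (simp add: abs_mult)
    also have "\<dots> \<le> 2 * \<bar>a\<bar> * \<bar>s u / 2\<bar> * \<bar>\<delta> u\<bar>"
      by (intro mult_mono abs_sin_x_le_abs_x mult_nonneg_nonneg order_refl) auto
    also have "\<dots> = u * (\<bar>a\<bar> * \<bar>q u\<bar> * \<bar>\<delta> u\<bar>)"
      using u by (simp add: q(1) abs_mult)
    finally have "\<bar>\<delta>' u\<bar> \<le> \<bar>a\<bar> * \<bar>q u\<bar> * \<bar>\<delta> u\<bar>"
      using u by (simp only: mult_le_cancel_left_pos)
    also have "\<dots> \<le> C * \<bar>\<delta> u\<bar>"
      unfolding C_def using K [of u] u by (intro mult_mono) auto
    finally show ?thesis .
  qed
  \<comment> \<open>Gronwall's integrating factor; the minus sign makes \<open>E\<close>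
    nondecreasing from \<open>E 0 = 0\<close>, while \<open>E \<le> 0\<close> by its form.\<close>
  define E where "E u = - ((\<delta> u)\<^sup>2 * exp (- 2 * C * u))" for u
  have "E 0 \<le> E x"
  proof (rule deriv_nonneg_imp_le [of 0 x E])
    show "continuous_on {0..x} E"
      unfolding E_def \<delta>_def
      by (intro continuous_intros solves_ivp_continuous [OF w] solves_ivp_continuous [OF v])
    fix u assume u: "0 < u" "u < x"
    have "(\<delta> has_real_derivative \<delta>' u) (at u)"
      unfolding \<delta>_def \<delta>'_def
      by (auto intro!: derivative_eq_intros solves_ivp_has_derivative [OF w] solves_ivp_has_derivative [OF v])
    hence "(E has_real_derivative 2 * exp (- 2 * C * u) * (C * (\<delta> u)\<^sup>2 - \<delta> u * \<delta>' u)) (at u)"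
      unfolding E_def by (auto intro!: derivative_eq_intros simp: algebra_simps)
    moreover have "\<delta> u * \<delta>' u \<le> C * (\<delta> u)\<^sup>2"
    proof -
      have "\<delta> u * \<delta>' u \<le> \<bar>\<delta> u\<bar> * \<bar>\<delta>' u\<bar>"
        by (metis abs_ge_self abs_mult)
      also have "\<dots> \<le> \<bar>\<delta> u\<bar> * (C * \<bar>\<delta> u\<bar>)"
        using bound [OF u] by (rule mult_left_mono) simp
      finally show ?thesis
        by (simp add: power2_eq_square mult_ac)
    qed
    ultimately show "\<exists>d\<ge>0. (E has_real_derivative d) (at u)"
      by (intro exI [of _ "2 * exp (- 2 * C * u) * (C * (\<delta> u)\<^sup>2 - \<delta> u * \<delta>' u)"] conjI) simp_all
  qed (use \<open>x > 0\<close> in simp)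
  hence "(\<delta> x)\<^sup>2 * exp (- 2 * C * x) \<le> 0"
    by (simp add: E_def \<delta>_def w0 v0)
  hence "\<delta> x = 0"
    by (simp add: mult_le_0_iff)
  thus ?thesis
    by (simp add: \<delta>_def)
qed

lemma ivp_solution_unique:
  assumes w: "solves_ivp a w" and v: "solves_ivp a v"
  shows "w = v"
proof
  fix x :: real
  consider "x > 0" | "x = 0" | "- x > 0" by linarith
  thus "w x = v x"
  proof cases
    case 1
    thus ?thesis by (rule ivp_solution_unique_right [OF w v])
  next
    case 2
    thus ?thesis using w v by (simp add: solves_ivp_def)
  next
    case 3
    from ivp_solution_unique_right [OF solves_ivp_reflect(1) [OF w] solves_ivp_reflect(1) [OF v] this]
    show ?thesis by simp
  qed
qed

text \<open>The product \<open>a * w\<close> treats both signs of \<open>a\<close> at once, and it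
  is carried to the negative semiaxis by the reflection, where the two sign changes cancel.\<close>

lemma ivp_solution_sign:
  assumes w: "solves_ivp a w" and "a \<noteq> 0"
  shows "a * w x \<le> 0" and "strict_mono_on {..<0} (\<lambda>x. a * w x)"
    and "strict_antimono_on {0<..} (\<lambda>x. a * w x)"
proof -
  have left: "a * w u < a * w v" if "u < v" "v \<le> 0" for u v
    using ivp_solution_strict_antimono_right [OF solves_ivp_reflect(1) [OF w], of "- v" "- u"] \<open>a \<noteq> 0\<close> that
    by simp
  have right: "a * w v < a * w u" if "u < v" "0 \<le> u" for u v
    using ivp_solution_strict_antimono_right [OF w] \<open>a \<noteq> 0\<close> that by blast
  have "w 0 = 0"
    using w by (simp add: solves_ivp_def)
  thus "a * w x \<le> 0"
    using left [of x 0] right [of 0 x] by (cases x "0 :: real" rule: linorder_cases) auto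
  show "strict_mono_on {..<0} (\<lambda>x. a * w x)"
    by (intro strict_mono_onI left) auto
  show "strict_antimono_on {0<..} (\<lambda>x. a * w x)"
    by (intro monotone_onI right) auto
qed

text \<open>The unique-existence clause ensures that the quantification over branches concerns
  exactly one function. The phase claim stands outside the guards \<open>a \<noteq> 0\<close>
  because it includes \<open>a = 0\<close>.\<close>

theorem proposition12:
  fixes a :: real
  defines "F0 \<equiv> hyp1F1_1 (\<i> * of_real a)"
    and "F1 \<equiv> hyp1F1_1 (1 + \<i> * of_real a)"
  shows
    "(a \<noteq> 0 \<longrightarrow>
       (\<lambda>z. G_hyp (\<i> * of_real a) (\<i> * z)) \<in> Hermite_Biehler \<and>
       (\<lambda>z. cnj (G_hyp (1 + \<i> * of_real a) (\<i> * cnj z))) \<in> Hermite_Biehler) \<and>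
     (a \<noteq> 0 \<longrightarrow>
       (\<forall>x::real. F0 (\<i> * of_real x) \<noteq> 0 \<and> F1 (\<i> * of_real x) \<noteq> 0) \<and>
       (\<forall>z. F0 (\<i> * z) = 0 \<longrightarrow> Im z < 0) \<and>
       (\<forall>z. F1 (\<i> * z) = 0 \<longrightarrow> Im z > 0) \<and>
       (\<forall>z. Im z \<ge> 0 \<longrightarrow> norm (F1 (\<i> * z)) \<le> norm (F0 (\<i> * z))) \<and>
       (\<forall>z. Im z \<ge> 0 \<longrightarrow> (norm (F1 (\<i> * z)) = norm (F0 (\<i> * z)) \<longleftrightarrow> z \<in> \<real>))) \<and>
     (\<exists>!y. is_arg_branch (\<lambda>x. F0 (\<i> * of_real x)) y) \<and>
     (\<forall>y. is_arg_branch (\<lambda>x. F0 (\<i> * of_real x)) y \<longrightarrow>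
       (a > 0 \<longrightarrow>
          real_analytic_on y UNIV \<and> (\<forall>x. y x \<le> 0) \<and>
          strict_mono_on {..<0} y \<and> strict_antimono_on {0<..} y) \<and>
       (a < 0 \<longrightarrow>
          real_analytic_on (\<lambda>x. - y x) UNIV \<and> (\<forall>x. - y x \<le> 0) \<and>
          strict_mono_on {..<0} (\<lambda>x. - y x) \<and> strict_antimono_on {0<..} (\<lambda>x. - y x)) \<and>
       (a \<noteq> 0 \<longrightarrow> solves_ivp a y \<and> (\<forall>w. solves_ivp a w \<longrightarrow> w = y)) \<and>
       (0 - 2 * y 0 = 0 \<and> strict_mono (\<lambda>x. x - 2 * y x)))"
proof -
  interpret hypergeometric_pair a .
  have F0: "F0 (\<i> * z) = exp (\<i> * z / 2) * f z" and F0_\<Phi>: "F0 (\<i> * z) = \<Phi> z"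
    and F1: "F1 (\<i> * z) = exp (\<i> * z / 2) * g z" for z
    by (simp_all add: F0_def F1_def \<Phi>_def f_def g_def hyp1F1_1_eq_exp_G_hyp)
  have HB: "(\<lambda>z. G_hyp (\<i> * of_real a) (\<i> * z)) \<in> Hermite_Biehler"
    "(\<lambda>z. cnj (G_hyp (1 + \<i> * of_real a) (\<i> * cnj z))) \<in> Hermite_Biehler"
    \<comment> \<open>By reflection the two functions coincide, so one membership yields
      both.\<close>
    using f_Hermite_Biehler unfolding G_hyp_reflect f_def [abs_def] by simp_all
  have zeros: "(\<forall>x::real. F0 (\<i> * of_real x) \<noteq> 0 \<and> F1 (\<i> * of_real x) \<noteq> 0) \<and>
      (\<forall>z. F0 (\<i> * z) = 0 \<longrightarrow> Im z < 0) \<and> (\<forall>z. F1 (\<i> * z) = 0 \<longrightarrow> Im z > 0)"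
    using f_nonzero g_nonzero unfolding F0 F1
    by (auto simp: not_less [symmetric])
  have norms: "(\<forall>z. Im z \<ge> 0 \<longrightarrow> norm (F1 (\<i> * z)) \<le> norm (F0 (\<i> * z))) \<and>
      (\<forall>z. Im z \<ge> 0 \<longrightarrow> (norm (F1 (\<i> * z)) = norm (F0 (\<i> * z)) \<longleftrightarrow> z \<in> \<real>))"
  proof (intro conjI allI impI)
    fix z :: complex assume z: "Im z \<ge> 0"
    show "norm (F1 (\<i> * z)) \<le> norm (F0 (\<i> * z))"
      \<comment> \<open>The modulus of \<open>exp (\<i> * z / 2)\<close> is a common positive factor
        and cancels.\<close>
      unfolding F0 F1 norm_mult using norm_g_le_norm_f [OF z] by simp
    show "norm (F1 (\<i> * z)) = norm (F0 (\<i> * z)) \<longleftrightarrow> z \<in> \<real>"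
      unfolding F0 F1 norm_mult complex_is_Real_iff
      using z norm_g_less_norm_f [of z] norm_g_eq_norm_f [of z] by (cases "Im z = 0") auto
  qed
  have nz: "\<Phi> (of_real x) \<noteq> 0" for x :: real
    by (simp add: \<Phi>_nonzero)
  have "continuous_on UNIV (\<lambda>x::real. \<Phi> (of_real x))"
    unfolding \<Phi>_eq by (intro continuous_intros) auto
  hence "\<exists>y. is_arg_branch (\<lambda>x. \<Phi> (of_real x)) y"
    using nz by (rule arg_branch_exists) (simp add: \<Phi>_eq)
  hence "\<exists>!y. is_arg_branch (\<lambda>x. \<Phi> (of_real x)) y"
    using arg_branch_unique [OF \<Phi>_holomorphic nz] by blast
  moreover have "(a > 0 \<longrightarrow>
          real_analytic_on y UNIV \<and> (\<forall>x. y x \<le> 0) \<and>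
          strict_mono_on {..<0} y \<and> strict_antimono_on {0<..} y) \<and>
       (a < 0 \<longrightarrow>
          real_analytic_on (\<lambda>x. - y x) UNIV \<and> (\<forall>x. - y x \<le> 0) \<and>
          strict_mono_on {..<0} (\<lambda>x. - y x) \<and> strict_antimono_on {0<..} (\<lambda>x. - y x)) \<and>
       (a \<noteq> 0 \<longrightarrow> solves_ivp a y \<and> (\<forall>w. solves_ivp a w \<longrightarrow> w = y)) \<and>
       (0 - 2 * y 0 = 0 \<and> strict_mono (\<lambda>x. x - 2 * y x))"
    if y: "is_arg_branch (\<lambda>x. \<Phi> (of_real x)) y" for y
  proof -
    have ivp: "solves_ivp a y"
      by (rule arg_branch_solves_ivp [OF y])
    note ana = arg_branch_real_analytic [OF \<Phi>_holomorphic nz y]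
    note sign = ivp_solution_sign [OF ivp]
    have "real_analytic_on y UNIV \<and> (\<forall>x. y x \<le> 0) \<and>
        strict_mono_on {..<0} y \<and> strict_antimono_on {0<..} y" if "a > 0"
      using ana sign that by (simp add: monotone_on_def mult_le_0_iff)
    moreover have "real_analytic_on (\<lambda>x. - y x) UNIV \<and> (\<forall>x. - y x \<le> 0) \<and>
        strict_mono_on {..<0} (\<lambda>x. - y x) \<and> strict_antimono_on {0<..} (\<lambda>x. - y x)" if "a < 0"
      using real_analytic_on_minus [OF ana] sign that by (simp add: monotone_on_def mult_le_0_iff)
    moreover have "0 - 2 * y 0 = 0"
      using ivp by (simp add: solves_ivp_def)
    ultimately show ?thesis
      using ivp ivp_solution_unique [OF _ ivp] phase_strict_mono [OF ivp] by blast
  qed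
  ultimately show ?thesis
    using HB zeros norms unfolding F0_\<Phi> by blast
qed

end
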